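(* Let $I$ be a set, let $(\theta_i)_{i \in I}$ be a family of elements of $\mathbb{R}$, and for $i \in I$ let $k_i \colon X_i \to X_i$ be a restricted Denjoy homeomorphism with rotation number $\theta_i$. Suppose that $1$ and the numbers $\theta_i$ for $i \in I$ are linearly independent over $\mathbb{Q}$. Then the product $k \colon \prod_{i \in I} X_i \to \prod_{i \in I} X_i$ of the homeomorphisms $k_i$ is minimal.
   Context: A Denjoy homeomorphism of $S^1$ is an orientation preserving homeomorphism of $S^1$ with irrational rotation number which is not conjugate to a rotation. Here the rotation number of an orientation preserving homeomorphism $f$ of $S^1 = \mathbb{R}/\mathbb{Z}$ is $\lim_{n \to \infty} (F^n(t) - t)/n$ modulo $\mathbb{Z}$, for any lift $F \colon \mathbb{R} \to \mathbb{R}$ of $f$ and any $t \in \mathbb{R}$; thus the rotation $\zeta \mapsto e^{2\pi i \theta}\zeta$ has rotation number $\theta$. A Denjoy homeomorphism has a unique minimal set (nonempty closed invariant subset, minimal with these properties), and this set is homeomorphic to the Cantor set. A restricted Denjoy homeomorphism is a homeomorphism of the Cantor set which is conjugate to the restriction and corestriction of a Denjoy homeomorphism of $S^1$ to its unique minimal set. Its rotation number is the rotation number of the Denjoy homeomorphism of $S^1$ of which it is the restriction. *)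

theory Defs
  imports "HOL-Analysis.Analysis"
begin

definition circle :: "complex topology" where
  "circle = top_of_set (sphere 0 1)"

definition circle_lift :: "(complex \<Rightarrow> complex) \<Rightarrow> (real \<Rightarrow> real) \<Rightarrow> bool" where
  "circle_lift f F \<longleftrightarrow>
     continuous_on UNIV F \<and> (\<forall>t. cis (2 * pi * F t) = f (cis (2 * pi * t)))"

definition orientation_preserving_homeo :: "(complex \<Rightarrow> complex) \<Rightarrow> bool" where
  "orientation_preserving_homeo f \<longleftrightarrow>
     homeomorphic_map circle circle f \<and> (\<exists>F. circle_lift f F \<and> strict_mono F)"

text \<open>The rotation number is an element of \<open>\<real>/\<int>\<close>; the real number \<open>\<theta>\<close> is any
  representative of it.\<close>

definition has_rotation_number :: "(complex \<Rightarrow> complex) \<Rightarrow> real \<Rightarrow> bool" where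
  "has_rotation_number f \<theta> \<longleftrightarrow>
     orientation_preserving_homeo f \<and>
     (\<forall>F t. circle_lift f F \<longrightarrow>
        (\<exists>m\<in>\<int>. (\<lambda>n. ((F ^^ n) t - t) / real n) \<longlonglongrightarrow> \<theta> + m))"

definition conjugate_maps ::
    "'a topology \<Rightarrow> ('a \<Rightarrow> 'a) \<Rightarrow> 'b topology \<Rightarrow> ('b \<Rightarrow> 'b) \<Rightarrow> bool" where
  "conjugate_maps X f Y g \<longleftrightarrow>
     (\<exists>h. homeomorphic_map X Y h \<and> (\<forall>x\<in>topspace X. h (f x) = g (h x)))"

definition denjoy_homeo :: "(complex \<Rightarrow> complex) \<Rightarrow> bool" where
  "denjoy_homeo f \<longleftrightarrow>
     orientation_preserving_homeo f \<and>
     (\<exists>\<theta>. has_rotation_number f \<theta> \<and> \<theta> \<notin> \<rat>) \<and>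
     \<not> (\<exists>\<alpha>. conjugate_maps circle f circle (\<lambda>z. cis (2 * pi * \<alpha>) * z))"

definition closed_invariant :: "'a topology \<Rightarrow> ('a \<Rightarrow> 'a) \<Rightarrow> 'a set \<Rightarrow> bool" where
  "closed_invariant X f T \<longleftrightarrow> closedin X T \<and> f ` T = T"

definition minimal_set :: "'a topology \<Rightarrow> ('a \<Rightarrow> 'a) \<Rightarrow> 'a set \<Rightarrow> bool" where
  "minimal_set X f M \<longleftrightarrow>
     closed_invariant X f M \<and> M \<noteq> {} \<and>
     (\<forall>T. closed_invariant X f T \<and> T \<noteq> {} \<and> T \<subseteq> M \<longrightarrow> T = M)"

definition minimal_homeo :: "'a topology \<Rightarrow> ('a \<Rightarrow> 'a) \<Rightarrow> bool" where
  "minimal_homeo X f \<longleftrightarrow>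
     homeomorphic_map X X f \<and> (\<forall>T. closed_invariant X f T \<longrightarrow> T = {} \<or> T = topspace X)"

definition cantor_space :: "(nat \<Rightarrow> bool) topology" where
  "cantor_space = product_topology (\<lambda>_. discrete_topology UNIV) UNIV"

text \<open>The minimal set \<open>M\<close> is unique, so quantifying over it existentially selects
  \<^emph>\<open>the\<close> minimal set of \<open>f\<close>. The rotation number is stated as a relation because the conjugacy
  may reverse orientation, so that \<open>k\<close> alone determines \<open>\<theta>\<close> modulo \<open>\<int>\<close> only up to sign.\<close>

definition restricted_denjoy_homeo :: "'a topology \<Rightarrow> ('a \<Rightarrow> 'a) \<Rightarrow> real \<Rightarrow> bool" where
  "restricted_denjoy_homeo X k \<theta> \<longleftrightarrow>
     X homeomorphic_space cantor_space \<and> homeomorphic_map X X k \<and>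
     (\<exists>f M. denjoy_homeo f \<and> has_rotation_number f \<theta> \<and> minimal_set circle f M \<and>
            conjugate_maps X k (subtopology circle M) f)"

lemma vector_space_rat_real: "vector_space (\<lambda>q::rat. (*) (of_rat q :: real))"
  by unfold_locales (auto simp: algebra_simps of_rat_add of_rat_mult)

text \<open>Independence of the family, not just of its range: \<open>v\<close> must be injective on \<open>J\<close>.\<close>

definition rat_independent_family :: "'j set \<Rightarrow> ('j \<Rightarrow> real) \<Rightarrow> bool" where
  "rat_independent_family J v \<longleftrightarrow>
     inj_on v J \<and> module.independent (\<lambda>q::rat. (*) (of_rat q :: real)) (v ` J)"

end

theory Submission
  imports Defs "HOL-Library.Real_Mod"
begin

text \<open>
  A nonempty closed invariant set of the product contains a whole forward orbit, so it is enough
  to see that every forward orbit meets every nonempty basic open box. Such a box constrains only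
  finitely many coordinates, and the times at which one coordinate returns to a prescribed open set
  are controlled by the rotation number alone: there is an open interval \<open>(a, b)\<close> such that
  every \<open>n\<close> for which \<open>n\<theta>\<close> lies in \<open>(a, b)\<close> modulo \<open>\<int>\<close> is a return time
  (\<open>restricted_denjoy_return_times\<close>). Kronecker's theorem on simultaneous approximation
  (\<open>kronecker_natural_multiplier\<close>) then provides one \<open>n\<close> that serves all the
  constrained coordinates.

  The interval comes from the order of the orbits. If \<open>F\<close> is a lift with rotation number
  \<open>\<rho>\<close>, exactly and not only modulo \<open>\<int>\<close>, then the lifted orbit
  \<open>F\<^sup>n x + m\<close> is ordered in \<open>\<real>\<close> as the numbers \<open>n\<rho> + m\<close>
  (\<open>orbit_ordered_as_rotation\<close>). In a minimal set each orbit enters a given relatively open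
  set infinitely often (\<open>minimal_set_orbit_returns\<close>), so a short arc contains two distinct
  points of the lifted orbit. Every lifted orbit point whose number \<open>n\<rho> + m\<close> lies between
  the numbers of these two then lies between them on the line, hence in the arc. This replaces the
  semiconjugacy of a Denjoy homeomorphism to its rotation: only the order on single orbits is used.
\<close>

section \<open>Kronecker's theorem with natural multipliers\<close>

text \<open>This bridges the independence over \<open>\<rat>\<close> of the hypothesis and the independence over
  \<open>\<int>\<close> on which Kronecker's theorem rests: integer coefficients are rational ones.\<close>

lemma rat_independent_imp_int_independent:
  assumes "module.independent (\<lambda>q::rat. (*) (of_rat q :: real)) S"
  shows "module.independent (\<lambda>r::int. (*) (of_int r :: real)) S"
proof -
  interpret Q: vector_space "\<lambda>q::rat. (*) (of_rat q :: real)"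
    by (rule vector_space_rat_real)
  interpret Z: Modules.module "\<lambda>r::int. (*) (of_int r :: real)"
    by unfold_locales (auto simp: algebra_simps)
  show ?thesis
    unfolding Z.independent_explicit_module
  proof (intro allI impI)
    fix t u v
    assume "finite t" "t \<subseteq> S" "(\<Sum>v\<in>t. of_int (u v) * v) = 0" "v \<in> t"
    then show "u v = 0"
      using Q.independentD[of S t "\<lambda>v. of_int (u v)" v] assms by simp
  qed
qed

text \<open>Kronecker's theorem allows a negative multiplier \<open>l\<close>, whereas orbits are followed forward.
  Dirichlet's theorem gives \<open>q > 0\<close> with all \<open>q\<theta>\<^sub>i\<close> so close to integers that even
  \<open>\<bar>l\<bar>q\<theta>\<^sub>i\<close> is nearly integral, and \<open>l + \<bar>l\<bar>q\<close> takes the place of \<open>l\<close>.\<close>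

lemma kronecker_natural_multiplier:
  fixes \<theta> \<alpha> :: "'i \<Rightarrow> real"
  assumes fin: "finite J" and sub: "J \<subseteq> I" and eps: "\<epsilon> > 0"
    and ind: "rat_independent_family (insert None (Some ` I)) (case_option 1 \<theta>)"
  obtains n :: nat and m :: "'i \<Rightarrow> int"
  where "\<And>i. i \<in> J \<Longrightarrow> \<bar>real n * \<theta> i + m i - \<alpha> i\<bar> < \<epsilon>"
proof -
  define N where "N = card J"
  obtain e where e: "bij_betw e {..<N} J"
    using ex_bij_betw_nat_finite[OF fin] by (auto simp: N_def atLeast0LessThan)
  \<comment> \<open>Kronecker's theorem takes a sequence whose last entry is \<open>1\<close>; \<open>g\<close> is the
    corresponding enumeration of the indices of the family.\<close>
  define \<phi> where "\<phi> = (\<lambda>j. if j < N then \<theta> (e j) else 1)"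
  define g where "g = (\<lambda>j. if j < N then Some (e j) else None)"
  have \<phi>g: "\<phi> = case_option 1 \<theta> \<circ> g"
    by (auto simp: \<phi>_def g_def)
  have gsub: "g ` {..N} \<subseteq> insert None (Some ` I)"
    using e sub by (auto simp: g_def bij_betw_def)
  have ginj: "inj_on g {..N}"
    using e by (auto simp: g_def bij_betw_def inj_on_def)
  have inj: "inj_on \<phi> {..N}"
    unfolding \<phi>g using ind gsub
    by (intro comp_inj_on ginj inj_on_subset[OF _ gsub]) (simp add: rat_independent_family_def)
  interpret Z: Modules.module "\<lambda>r::int. (*) (of_int r :: real)"
    by unfold_locales (auto simp: algebra_simps)
  have "\<phi> ` {..N} \<subseteq> case_option 1 \<theta> ` insert None (Some ` I)"
    unfolding \<phi>g image_comp[symmetric] by (rule image_mono[OF gsub])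
  then have ind': "Z.independent (\<phi> ` {..N})"
    using ind rat_independent_imp_int_independent Z.independent_mono
    unfolding rat_independent_family_def by blast
  obtain l r where l: "\<And>j. j < N \<Longrightarrow> \<bar>of_int l * \<phi> j - of_int (r j) - \<alpha> (e j)\<bar> < \<epsilon>/2"
    using Kronecker_thm_2[of \<phi> N "\<epsilon>/2" "\<lambda>j. \<alpha> (e j)"] ind' inj eps
    by (auto simp: \<phi>_def)
  obtain P :: nat where P: "real P > 2 * \<bar>of_int l\<bar> / \<epsilon>"
    using reals_Archimedean2 by blast
  have "0 \<le> 2 * \<bar>real_of_int l\<bar> / \<epsilon>"
    using eps by simp
  with P have P0: "P > 0"
    by (metis less_le_trans not_gr_zero of_nat_0 not_less)
  obtain q p where "0 < q" and q: "\<And>j. j < N \<Longrightarrow> \<bar>of_int q * \<phi> j - of_int (p j)\<bar> < 1 / real P"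
    using Dirichlet_approx_simult[OF P0, of N \<phi>] by metis
  define n where "n = nat (l + \<bar>l\<bar> * q)"
  have "\<bar>l\<bar> * 1 \<le> \<bar>l\<bar> * q"
    using \<open>0 < q\<close> by (intro mult_left_mono) auto
  then have n: "real n = of_int l + \<bar>of_int l\<bar> * of_int q"
    by (simp add: n_def)
  have key: "\<bar>real n * \<phi> j + of_int (- r j - \<bar>l\<bar> * p j) - \<alpha> (e j)\<bar> < \<epsilon>" if "j < N" for j
  proof -
    have "real n * \<phi> j + of_int (- r j - \<bar>l\<bar> * p j) - \<alpha> (e j)
        = (of_int l * \<phi> j - of_int (r j) - \<alpha> (e j)) + \<bar>of_int l\<bar> * (of_int q * \<phi> j - of_int (p j))"
      by (simp add: n algebra_simps)
    moreover have "\<bar>\<bar>of_int l\<bar> * (of_int q * \<phi> j - of_int (p j))\<bar> \<le> \<bar>of_int l\<bar> * (1 / real P)"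
      unfolding abs_mult abs_abs using q[OF that] by (intro mult_left_mono) auto
    moreover have "\<bar>of_int l\<bar> * (1 / real P) \<le> \<epsilon>/2"
      using P P0 eps by (simp add: field_simps)
    ultimately show ?thesis
      using l[OF that] by linarith
  qed
  define e' where "e' = inv_into {..<N} e"
  have e': "e' i < N" "e (e' i) = i" if "i \<in> J" for i
    using that e by (auto simp: e'_def bij_betw_def f_inv_into_f intro: inv_into_into[of i e "{..<N}", simplified])
  show thesis
  proof (rule that[of n "\<lambda>i. - r (e' i) - \<bar>l\<bar> * p (e' i)"])
    fix i assume "i \<in> J"
    with key[of "e' i"] e'[of i]
    show "\<bar>real n * \<theta> i + of_int (- r (e' i) - \<bar>l\<bar> * p (e' i)) - \<alpha> i\<bar> < \<epsilon>"
      by (simp add: \<phi>_def)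
  qed
qed

section \<open>Lifts of circle homeomorphisms and the order of their orbits\<close>

lemma cis_2pi_eq_iff: "cis (2 * pi * s) = cis (2 * pi * t) \<longleftrightarrow> (\<exists>m::int. s = t + m)"
proof -
  have "cis (2 * pi * s) = cis (2 * pi * t) \<longleftrightarrow> cis (2 * pi * s - 2 * pi * t) = 1"
    by (simp add: cis_divide[symmetric])
  also have "\<dots> \<longleftrightarrow> (\<exists>m::int. s = t + m)"
    unfolding cis_eq_1_iff right_diff_distrib[symmetric] mult.commute[of "of_int _" "2 * pi"]
  proof (rule ex_cong1)
    fix m :: int
    have "2 * pi * (s - t) = 2 * pi * of_int m \<longleftrightarrow> s - t = of_int m"
      by simp
    then show "2 * pi * (s - t) = 2 * pi * of_int m \<longleftrightarrow> s = t + of_int m"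
      by (simp only: diff_eq_eq add.commute)
  qed
  finally show ?thesis .
qed

text \<open>The increment of \<open>F\<close> over a period is an integer, positive by monotonicity, and an
  increment of two or more would make \<open>f\<close> identify two points of the circle.\<close>

lemma lift_add_int:
  assumes lift: "circle_lift f F" and mono: "strict_mono F" and inj: "inj_on f (sphere 0 1)"
  shows "F (t + of_int m) = F t + of_int m"
proof -
  have one: "F (t + 1) = F t + 1" for t
  proof -
    have F: "cis (2 * pi * F t) = f (cis (2 * pi * t))" for t
      using lift by (simp add: circle_lift_def)
    have "cis (2 * pi * (t + 1)) = cis (2 * pi * t)"
      unfolding cis_2pi_eq_iff by (rule exI[of _ 1]) simp
    then have "cis (2 * pi * F (t + 1)) = cis (2 * pi * F t)"
      by (simp add: F)
    then obtain d :: int where d: "F (t + 1) = F t + d"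
      unfolding cis_2pi_eq_iff by blast
    have "F t < F (t + 1)"
      using mono by (simp add: strict_mono_def)
    with d have "d \<ge> 1" by simp
    \<comment> \<open>If the degree were at least two, \<open>F\<close> would take the value \<open>F t + 1\<close> strictly inside
      the period, where injectivity of \<open>f\<close> forbids it.\<close>
    moreover have False if "d \<ge> 2"
    proof -
      have "F t \<le> F t + 1" "F t + 1 \<le> F (t + 1)"
        using that d by auto
      then obtain s where s: "t \<le> s" "s \<le> t + 1" "F s = F t + 1"
        using IVT'[of F t "F t + 1" "t + 1"] lift
        by (auto simp: circle_lift_def intro: continuous_on_subset)
      have "s \<noteq> t" "s \<noteq> t + 1"
        using s d that by auto
      have "cis (2 * pi * F s) = cis (2 * pi * F t)"
        unfolding cis_2pi_eq_iff by (rule exI[of _ 1]) (simp add: s)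
      then have "cis (2 * pi * s) = cis (2 * pi * t)"
        using inj by (auto simp: F inj_on_def)
      then obtain j :: int where "s = t + j"
        unfolding cis_2pi_eq_iff by blast
      then have "0 < j" "j < 1"
        using s \<open>s \<noteq> t\<close> \<open>s \<noteq> t + 1\<close> by auto
      then show False by simp
    qed
    ultimately have "d = 1" by force
    then show ?thesis using d by simp
  qed
  have nat: "F (t + real n) = F t + real n" for t n
  proof (induction n)
    case (Suc n)
    then show ?case using one[of "t + real n"] by (simp add: algebra_simps)
  qed simp
  show ?thesis
  proof (cases "m \<ge> 0")
    case True
    then show ?thesis using nat[of t "nat m"] by simp
  next
    case False
    then show ?thesis using nat[of "t + of_int m" "nat (- m)"] by simp
  qed
qed

lemma lift_funpow:
  assumes "circle_lift f F"
  shows "cis (2 * pi * (F ^^ n) t) = (f ^^ n) (cis (2 * pi * t))"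
  using assms by (induction n) (auto simp: circle_lift_def)

lemma funpow_add_int:
  fixes F :: "real \<Rightarrow> real"
  assumes "\<And>t (m::int). F (t + of_int m) = F t + of_int m"
  shows "(F ^^ n) (t + of_int m) = (F ^^ n) t + of_int m"
  by (induction n) (auto simp: assms)

text \<open>Comparing \<open>F\<^sup>q\<close> with an integer translation controls the iterates only at the times
  \<open>qj + n\<close>; this evaluates the rotation number along these times.\<close>

lemma rotation_number_along_progression:
  fixes F :: "real \<Rightarrow> real"
  assumes lim: "(\<lambda>n. ((F ^^ n) x - x) / real n) \<longlonglongrightarrow> \<rho>" and q: "q > 0"
  shows "(\<lambda>j. (F ^^ (q * j + n)) x / real j) \<longlonglongrightarrow> real q * \<rho>"
proof -
  have "strict_mono (\<lambda>j. q * j + n)"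
    using q by (auto simp: strict_mono_def)
  from LIMSEQ_subseq_LIMSEQ[OF lim this]
  have 1: "(\<lambda>j. ((F ^^ (q * j + n)) x - x) / real (q * j + n)) \<longlonglongrightarrow> \<rho>"
    by (simp add: o_def)
  have "(\<lambda>j. real q + real n / real j) \<longlonglongrightarrow> real q + 0"
    by (intro tendsto_intros lim_const_over_n)
  moreover have "eventually (\<lambda>j. real q + real n / real j = real (q * j + n) / real j) sequentially"
    using eventually_gt_at_top[of 0] by eventually_elim (simp add: field_simps)
  ultimately have 2: "(\<lambda>j. real (q * j + n) / real j) \<longlonglongrightarrow> real q"
    by (auto elim: Lim_transform_eventually)
  have "(\<lambda>j. ((F ^^ (q * j + n)) x - x) / real (q * j + n) * (real (q * j + n) / real j) + x / real j)
      \<longlonglongrightarrow> \<rho> * real q + 0"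
    by (intro tendsto_intros 1 2 lim_const_over_n)
  moreover have "eventually (\<lambda>j. ((F ^^ (q * j + n)) x - x) / real (q * j + n) * (real (q * j + n) / real j) + x / real j
      = (F ^^ (q * j + n)) x / real j) sequentially"
    using eventually_gt_at_top[of 0]
  proof eventually_elim
    case (elim j)
    then have "real (q * j + n) \<noteq> 0" "real j \<noteq> 0" using q by (auto simp del: of_nat_add)
    have "(u - v) / c * (c / d) + v / d = u / d" if "c \<noteq> 0" for u v c d :: real
      using that by (simp flip: add_divide_distrib)
    from this[OF \<open>real (q * j + n) \<noteq> 0\<close>] show ?case .
  qed
  ultimately show ?thesis
    by (auto elim: Lim_transform_eventually simp: mult.commute)
qed

text \<open>If \<open>F\<^sup>q\<close> moves the orbit point \<open>F\<^sup>n x\<close> by at least \<open>p\<close>, then, since it is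
  monotone and commutes with integer translations, it moves that point by at least \<open>jp\<close> when
  applied \<open>j\<close> times; dividing by \<open>j\<close> bounds the rotation number. The other bound is
  symmetric.\<close>

lemma rotation_number_bounds:
  fixes F :: "real \<Rightarrow> real" and p :: int and q n :: nat and \<rho> :: real
  assumes mono: "mono F" and per: "\<And>t (m::int). F (t + of_int m) = F t + of_int m"
    and lim: "(\<lambda>n. ((F ^^ n) x - x) / real n) \<longlonglongrightarrow> \<rho>" and q: "q > 0"
  shows "(F ^^ n) x + p \<le> (F ^^ (q + n)) x \<Longrightarrow> p \<le> real q * \<rho>"
    and "(F ^^ (q + n)) x \<le> (F ^^ n) x + p \<Longrightarrow> q * \<rho> \<le> p"
proof -
  note L = rotation_number_along_progression[OF lim q, of n]
  have mono': "mono (F ^^ q)"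
    by (rule mono_pow[OF mono])
  have per': "(F ^^ q) (t + of_int m) = (F ^^ q) t + of_int m" for t m
    by (rule funpow_add_int) (rule per)
  have step: "(F ^^ (q * Suc j + n)) x = (F ^^ q) ((F ^^ (q * j + n)) x)" for j
    by (simp add: funpow_add add.assoc)
  have shift: "(F ^^ q) ((F ^^ n) x + of_int m) = (F ^^ (q + n)) x + of_int m" for m
    by (simp add: per' funpow_add)
  have R: "(\<lambda>j. (F ^^ n) x / real j + p) \<longlonglongrightarrow> of_int p"
    using tendsto_add[OF lim_const_over_n tendsto_const] by simp
  have R': "eventually (\<lambda>j. (F ^^ n) x / real j + p = ((F ^^ n) x + of_int (int j * p)) / real j) sequentially"
    using eventually_gt_at_top[of 0] by eventually_elim (simp add: field_simps)
  show "p \<le> q * \<rho>" if a: "(F ^^ n) x + p \<le> (F ^^ (q + n)) x"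
  proof -
    have le: "(F ^^ n) x + of_int (int j * p) \<le> (F ^^ (q * j + n)) x" for j
    proof (induction j)
      case (Suc j)
      have "(F ^^ q) ((F ^^ n) x + of_int (int j * p)) \<le> (F ^^ (q * Suc j + n)) x"
        unfolding step by (rule monoD[OF mono' Suc])
      then show ?case using a unfolding shift by (simp add: algebra_simps)
    qed simp
    have "eventually (\<lambda>j. (F ^^ n) x / real j + p \<le> (F ^^ (q * j + n)) x / real j) sequentially"
      using R' by eventually_elim (use le in \<open>simp add: divide_right_mono\<close>)
    from tendsto_le[OF sequentially_bot L R this] show ?thesis .
  qed
  show "q * \<rho> \<le> p" if a: "(F ^^ (q + n)) x \<le> (F ^^ n) x + p"
  proof -
    have le: "(F ^^ (q * j + n)) x \<le> (F ^^ n) x + of_int (int j * p)" for j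
    proof (induction j)
      case (Suc j)
      have "(F ^^ (q * Suc j + n)) x \<le> (F ^^ q) ((F ^^ n) x + of_int (int j * p))"
        unfolding step by (rule monoD[OF mono' Suc])
      then show ?case using a unfolding shift by (simp add: algebra_simps)
    qed simp
    have "eventually (\<lambda>j. (F ^^ (q * j + n)) x / real j \<le> (F ^^ n) x / real j + p) sequentially"
      using R' by eventually_elim (use le in \<open>simp add: divide_right_mono\<close>)
    from tendsto_le[OF sequentially_bot R L this] show ?thesis .
  qed
qed

text \<open>If the points were in the opposite order, the iterate of \<open>F\<close> that leads from the one with
  the smaller exponent to the other would move it by at least, or at most, an integer, and the
  resulting bound on \<open>\<rho>\<close> would reverse the assumed inequality.\<close>

lemma orbit_ordered_as_rotation:
  fixes F :: "real \<Rightarrow> real" and m1 m2 :: int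
  assumes mono: "mono F" and per: "\<And>t (m::int). F (t + of_int m) = F t + of_int m"
    and lim: "(\<lambda>n. ((F ^^ n) x - x) / real n) \<longlonglongrightarrow> \<rho>"
    and less: "real n1 * \<rho> + m1 < real n2 * \<rho> + m2"
  shows "(F ^^ n1) x + m1 < (F ^^ n2) x + m2"
proof (rule ccontr)
  assume "\<not> ?thesis"
  then have le: "(F ^^ n2) x + m2 \<le> (F ^^ n1) x + m1" by simp
  note B = rotation_number_bounds[OF mono per lim]
  consider "n1 = n2" | "n2 < n1" | "n1 < n2" by linarith
  then show False
  proof cases
    case 1
    then show False using le less by simp
  next
    case 2
    have "of_int (m2 - m1) \<le> real (n1 - n2) * \<rho>"
      using 2 le by (intro B(1)[where n = n2]) auto
    then show False using 2 less by (simp add: of_nat_diff algebra_simps)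
  next
    case 3
    have "real (n2 - n1) * \<rho> \<le> of_int (m1 - m2)"
      using 3 le by (intro B(2)[where n = n1]) auto
    then show False using 3 less by (simp add: of_nat_diff algebra_simps)
  qed
qed

section \<open>Recurrence in minimal sets\<close>

lemma funpow_in_invariant:
  assumes "f ` T = T" "x \<in> T"
  shows "(f ^^ n) x \<in> T"
  using assms by (induction n) auto

text \<open>The set of limit points of the forward orbit, an intersection of closures of tails, is nonempty
  by compactness, and \<open>f\<close> maps it onto itself because it maps each tail onto the next one.
  By minimality it is all of \<open>M\<close>.\<close>

lemma minimal_set_orbit_returns:
  assumes comp: "compact_space X" and f: "homeomorphic_map X X f" and M: "minimal_set X f M"
    and z: "z \<in> M" and U: "openin X U" "U \<inter> M \<noteq> {}"
  obtains n where "n \<ge> N" "(f ^^ n) z \<in> U"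
proof -
  define S where "S = (\<lambda>N. (\<lambda>n. (f ^^ n) z) ` {N..})"
  define C where "C = (\<lambda>N. X closure_of S N)"
  have clM: "closedin X M" and inv: "f ` M = M"
    using M by (auto simp: minimal_set_def closed_invariant_def)
  have SM: "S N \<subseteq> M" for N
    using funpow_in_invariant[OF inv z] by (auto simp: S_def)
  have MX: "M \<subseteq> topspace X"
    using clM closedin_subset by auto
  have "f ` S N = S (Suc N)" for N
  proof -
    have "{Suc N..} = Suc ` {N..}"
      by (auto simp: image_iff Suc_le_eq gr0_conv_Suc dest: Suc_le_D)
    then show ?thesis by (simp add: S_def image_image)
  qed
  then have fC: "f ` C N = C (Suc N)" for N
    unfolding C_def using homeomorphic_map_closure_of[OF f, of "S N"] SM[of N] MX by auto
  have clC: "closedin X (C N)" for N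
    by (simp add: C_def)
  have dec: "decseq C"
    by (auto simp: C_def S_def decseq_def intro!: closure_of_mono image_mono)
  have CM: "C N \<subseteq> M" for N
    unfolding C_def by (rule closure_of_minimal[OF SM clM])
  have ne: "C N \<noteq> {}" for N
    using closure_of_subset[of "S N" X] SM[of N] MX by (auto simp: C_def S_def)
  define W where "W = (\<Inter>N. C N)"
  have "W \<noteq> {}"
    unfolding W_def by (rule compact_space_imp_nest[OF comp clC ne dec])
  moreover have "W \<subseteq> M"
    using CM by (auto simp: W_def)
  moreover have "f ` W = W"
  proof -
    \<comment> \<open>Injectivity lets the image commute with the intersection.\<close>
    have "inj_on f (topspace X)"
      using f by (rule homeomorphic_imp_injective_map)
    then have "f ` W = (\<Inter>N. f ` C N)"
      unfolding W_def by (rule image_INT[of _ _ _ _ 0]) (use clC closedin_subset in auto)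
    also have "\<dots> = (\<Inter>N. C (Suc N))"
      by (simp add: fC)
    also have "\<dots> = W"
      using decseqD[OF dec, OF le_SucI[OF order_refl]] by (fastforce simp: W_def)
    finally show ?thesis .
  qed
  moreover have "closedin X W"
    unfolding W_def using clC by auto
  ultimately have "W = M"
    using M by (auto simp: minimal_set_def closed_invariant_def)
  with U obtain w where "w \<in> U" "w \<in> C N"
    by (auto simp: W_def)
  then have "U \<inter> S N \<noteq> {}"
    using U(1) by (auto simp: C_def in_closure_of)
  then show thesis
    using that by (auto simp: S_def)
qed

section \<open>Return times contain a rotation interval\<close>

text \<open>The covering \<open>t \<mapsto> cis (2\<pi>t)\<close> is open at every \<open>t\<close>, since the principal argument, divided by
  \<open>2\<pi>\<close>, is a continuous inverse of it near \<open>1\<close>. It turns visits to a neighbourhood on the circle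
  into visits of the lifted orbit to an interval.\<close>

lemma nearby_angles:
  assumes "\<delta> > 0"
  obtains W where "open W" "cis (2 * pi * t) \<in> W"
    "\<And>z. z \<in> W \<Longrightarrow> norm z = 1 \<Longrightarrow> \<exists>s. \<bar>s - t\<bar> < \<delta> \<and> z = cis (2 * pi * s)"
proof -
  define w where "w = cis (2 * pi * t)"
  have w: "w \<noteq> 0" "norm w = 1" by (auto simp: w_def)
  have "isCont (\<lambda>z. Arg (z / w)) w"
    using w by (intro continuous_intros isCont_o2[where g = Arg and f = "\<lambda>z. z / w"] continuous_at_Arg) auto
  then have "((\<lambda>z. Arg (z / w)) \<longlongrightarrow> Arg (w / w)) (nhds w)"
    unfolding isCont_def tendsto_at_iff_tendsto_nhds[of "\<lambda>z. Arg (z / w)"] .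
  then have "((\<lambda>z. Arg (z / w)) \<longlongrightarrow> 0) (nhds w)"
    using w by simp
  then have "eventually (\<lambda>z. \<bar>Arg (z / w)\<bar> < 2 * pi * \<delta>) (nhds w)"
    using assms by (auto simp: tendsto_iff dist_real_def)
  then obtain W where W: "open W" "w \<in> W" "\<And>z. z \<in> W \<Longrightarrow> \<bar>Arg (z / w)\<bar> < 2 * pi * \<delta>"
    unfolding eventually_nhds by blast
  show thesis
  proof (rule that[of W])
    fix z assume z: "z \<in> W" "norm z = 1"
    have "cis (Arg (z / w)) = z / w"
      using z w by (subst cis_Arg) (auto simp: sgn_div_norm norm_divide)
    then have "z = cis (Arg (z / w) + 2 * pi * t)"
      using w by (simp add: cis_mult[symmetric] w_def[symmetric])
    also have "Arg (z / w) + 2 * pi * t = 2 * pi * (t + Arg (z / w) / (2 * pi))"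
      by (simp add: distrib_left)
    finally have "z = cis (2 * pi * (t + Arg (z / w) / (2 * pi)))" .
    moreover have "\<bar>t + Arg (z / w) / (2 * pi) - t\<bar> < \<delta>"
      using W(3)[OF z(1)] by (simp add: abs_divide field_simps abs_mult)
    ultimately show "\<exists>s. \<bar>s - t\<bar> < \<delta> \<and> z = cis (2 * pi * s)" by blast
  qed (use W in \<open>auto simp: w_def\<close>)
qed

text \<open>Two visits of the orbit of \<open>z\<close> to a small arc inside \<open>V\<close>, at different times
  \<open>n1\<close> and \<open>n2\<close>, lift to two points of an interval. The ends of \<open>(a, b)\<close> are the
  corresponding numbers \<open>n1\<rho> + m1\<close> and \<open>n2\<rho> + m2\<close>, distinct because \<open>\<rho>\<close> is
  irrational, and the orbit is ordered as these numbers.\<close>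

lemma circle_return_times_contain_rotation_interval:
  assumes rot: "has_rotation_number f \<theta>" and irr: "\<theta> \<notin> \<rat>"
    and M: "minimal_set circle f M" and z: "z \<in> M" and V: "open V" "V \<inter> M \<noteq> {}"
  obtains a b :: real where "a < b"
    "\<And>(n::nat) (m::int). a < real n * \<theta> + m \<Longrightarrow> real n * \<theta> + m < b \<Longrightarrow> (f ^^ n) z \<in> V"
proof -
  obtain F where lift: "circle_lift f F" and smono: "strict_mono F" and hom: "homeomorphic_map circle circle f"
    using rot by (auto simp: has_rotation_number_def orientation_preserving_homeo_def)
  have top: "topspace circle = sphere 0 1"
    by (simp add: circle_def)
  have MS: "M \<subseteq> sphere 0 1"
    using M closedin_subset[of circle M] by (auto simp: minimal_set_def closed_invariant_def top)
  have inj: "inj_on f (sphere 0 1)"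
    using homeomorphic_imp_injective_map[OF hom] by (simp add: top)
  have per: "F (t + of_int m) = F t + of_int m" for t m
    by (rule lift_add_int[OF lift smono inj])
  have angle: "\<exists>t. y = cis (2 * pi * t)" if "y \<in> M" for y
  proof -
    have "norm y = 1" using that MS by auto
    then have "y = cis (2 * pi * (Arg y / (2 * pi)))"
      using cis_Arg[of y] by (cases "y = 0") (auto simp: sgn_div_norm)
    then show ?thesis by blast
  qed
  obtain x where x: "z = cis (2 * pi * x)"
    using angle[OF z] by blast
  \<comment> \<open>The given representative \<open>\<theta>\<close> differs by an integer from the rotation number
    \<open>\<rho>\<close> of the chosen lift.\<close>
  obtain d0 where d0: "d0 \<in> \<int>" and lim0: "(\<lambda>n. ((F ^^ n) x - x) / real n) \<longlonglongrightarrow> \<theta> + d0"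
    using rot lift unfolding has_rotation_number_def by blast
  obtain d where d: "d0 = of_int d" using d0 by (auto elim: Ints_cases)
  define \<rho> where "\<rho> = \<theta> + of_int d"
  have lim: "(\<lambda>n. ((F ^^ n) x - x) / real n) \<longlonglongrightarrow> \<rho>"
    using lim0 by (simp add: \<rho>_def d)
  note order = orbit_ordered_as_rotation[OF strict_mono_mono[OF smono] per lim]
  obtain t where t: "cis (2 * pi * t) \<in> V" "cis (2 * pi * t) \<in> M"
    using V angle by blast
  have "continuous_on UNIV (\<lambda>s. cis (2 * pi * s))"
    by (intro continuous_intros)
  then have "isCont (\<lambda>s. cis (2 * pi * s)) t"
    by (simp add: continuous_on_eq_continuous_at)
  then have "((\<lambda>s. cis (2 * pi * s)) \<longlongrightarrow> cis (2 * pi * t)) (nhds t)"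
    unfolding isCont_def tendsto_at_iff_tendsto_nhds[of "\<lambda>s. cis (2 * pi * s)"] .
  then have "eventually (\<lambda>s. cis (2 * pi * s) \<in> V) (nhds t)"
    using V(1) t(1) by (rule topological_tendstoD)
  then obtain \<delta> where \<delta>: "\<delta> > 0" "\<And>s. \<bar>s - t\<bar> < \<delta> \<Longrightarrow> cis (2 * pi * s) \<in> V"
    by (auto simp: eventually_nhds_metric dist_real_def)
  obtain W where W: "open W" "cis (2 * pi * t) \<in> W"
    "\<And>y. y \<in> W \<Longrightarrow> norm y = 1 \<Longrightarrow> \<exists>s. \<bar>s - t\<bar> < \<delta> \<and> y = cis (2 * pi * s)"
    using nearby_angles[OF \<delta>(1)] by blast
  have comp: "compact_space circle"
    by (simp add: circle_def compact_space_subtopology)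
  have ret: "\<exists>n\<ge>N. \<exists>m::int. \<bar>(F ^^ n) x + m - t\<bar> < \<delta>" for N
  proof -
    have "openin circle (W \<inter> sphere 0 1)" "(W \<inter> sphere 0 1) \<inter> M \<noteq> {}"
      using W t MS by (auto simp: circle_def openin_open)
    from minimal_set_orbit_returns[OF comp hom M z this]
    obtain n where n: "n \<ge> N" "(f ^^ n) z \<in> W \<inter> sphere 0 1" by blast
    then obtain s where s: "\<bar>s - t\<bar> < \<delta>" "(f ^^ n) z = cis (2 * pi * s)"
      using W(3) by auto
    then have "cis (2 * pi * s) = cis (2 * pi * (F ^^ n) x)"
      by (simp add: lift_funpow[OF lift] x)
    then obtain m :: int where "s = (F ^^ n) x + m"
      unfolding cis_2pi_eq_iff by blast
    with s n show ?thesis by blast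
  qed
  obtain n1 and m1 :: int where 1: "\<bar>(F ^^ n1) x + m1 - t\<bar> < \<delta>"
    using ret[of 0] by blast
  obtain n2 and m2 :: int where 2: "n2 \<ge> Suc n1" "\<bar>(F ^^ n2) x + m2 - t\<bar> < \<delta>"
    using ret[of "Suc n1"] by blast
  define r1 where "r1 = real n1 * \<rho> + m1"
  define r2 where "r2 = real n2 * \<rho> + m2"
  have "\<rho> \<notin> \<rat>"
    using irr Rats_diff[of \<rho> "of_int d"] by (auto simp: \<rho>_def)
  have "r1 \<noteq> r2"
  proof
    assume "r1 = r2"
    then have "\<rho> = of_int (m1 - m2) / of_nat (n2 - n1)"
      using 2(1) by (simp add: r1_def r2_def of_nat_diff field_simps)
    also have "\<dots> \<in> \<rat>"
      by (intro Rats_divide Rats_of_int Rats_of_nat)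
    finally show False using \<open>\<rho> \<notin> \<rat>\<close> by contradiction
  qed
  show thesis
  proof (rule that[of "min r1 r2" "max r1 r2"])
    show "min r1 r2 < max r1 r2" using \<open>r1 \<noteq> r2\<close> by auto
  next
    fix n and m :: int
    assume a: "min r1 r2 < real n * \<theta> + m" "real n * \<theta> + m < max r1 r2"
    define m' where "m' = m - int n * d"
    have m': "real n * \<theta> + m = real n * \<rho> + m'"
      by (simp add: m'_def \<rho>_def algebra_simps)
    have "r1 < real n * \<rho> + m' \<and> real n * \<rho> + m' < r2 \<or> r2 < real n * \<rho> + m' \<and> real n * \<rho> + m' < r1"
      using a unfolding m' by linarith
    then have "(F ^^ n1) x + m1 < (F ^^ n) x + m' \<and> (F ^^ n) x + m' < (F ^^ n2) x + m2 \<or>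
      (F ^^ n2) x + m2 < (F ^^ n) x + m' \<and> (F ^^ n) x + m' < (F ^^ n1) x + m1"
      unfolding r1_def r2_def using order by blast
    then have "\<bar>(F ^^ n) x + m' - t\<bar> < \<delta>"
      using 1 2(2) by linarith
    then have "cis (2 * pi * ((F ^^ n) x + m')) \<in> V"
      by (rule \<delta>(2))
    moreover have "cis (2 * pi * ((F ^^ n) x + m')) = cis (2 * pi * (F ^^ n) x)"
      unfolding cis_2pi_eq_iff by blast
    ultimately show "(f ^^ n) z \<in> V"
      by (simp add: lift_funpow[OF lift] x)
  qed
qed

text \<open>The irrational rotation number in the definition of a Denjoy homeomorphism and \<open>\<theta>\<close> are
  limits along the same orbit of one lift, up to integers.\<close>

lemma denjoy_rotation_number_irrational:
  assumes "denjoy_homeo f" "has_rotation_number f \<theta>"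
  shows "\<theta> \<notin> \<rat>"
proof
  assume \<theta>: "\<theta> \<in> \<rat>"
  obtain \<theta>' F where \<theta>': "has_rotation_number f \<theta>'" "\<theta>' \<notin> \<rat>" and F: "circle_lift f F"
    using assms(1) by (auto simp: denjoy_homeo_def orientation_preserving_homeo_def)
  obtain m where m: "m \<in> \<int>" "(\<lambda>n. ((F ^^ n) 0 - 0) / real n) \<longlonglongrightarrow> \<theta> + m"
    using assms(2) F unfolding has_rotation_number_def by blast
  obtain m' where m': "m' \<in> \<int>" "(\<lambda>n. ((F ^^ n) 0 - 0) / real n) \<longlonglongrightarrow> \<theta>' + m'"
    using \<theta>' F unfolding has_rotation_number_def by blast
  have "\<theta>' = \<theta> + m - m'"
    using LIMSEQ_unique[OF m(2) m'(2)] by simp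
  moreover have "\<theta> + m - m' \<in> \<rat>"
    using \<theta> m m' Ints_subset_Rats by (intro Rats_diff Rats_add) auto
  ultimately show False using \<theta>' by simp
qed

text \<open>Return times are invariant under conjugacy, so they can be read off on the circle.\<close>

lemma restricted_denjoy_return_times:
  assumes k: "restricted_denjoy_homeo X k \<theta>"
    and x: "x \<in> topspace X" and U: "openin X U" "U \<noteq> {}"
  obtains a b :: real where "a < b"
    "\<And>(n::nat) (m::int). a < real n * \<theta> + m \<Longrightarrow> real n * \<theta> + m < b \<Longrightarrow> (k ^^ n) x \<in> U"
proof -
  obtain f M h where f: "denjoy_homeo f" "has_rotation_number f \<theta>" and M: "minimal_set circle f M"
    and h: "homeomorphic_map X (subtopology circle M) h"
    and conj: "\<And>x. x \<in> topspace X \<Longrightarrow> h (k x) = f (h x)" and hk: "homeomorphic_map X X k"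
    using k by (auto simp: restricted_denjoy_homeo_def conjugate_maps_def)
  have MS: "M \<subseteq> topspace circle"
    using M closedin_subset[of circle M] by (auto simp: minimal_set_def closed_invariant_def)
  have himg: "h ` topspace X = M"
    using homeomorphic_imp_surjective_map[OF h] MS by auto
  have UX: "U \<subseteq> topspace X"
    using U openin_subset by auto
  have kx: "(k ^^ n) x \<in> topspace X" for n
    using funpow_in_invariant[OF homeomorphic_imp_surjective_map[OF hk] x] .
  have hkx: "h ((k ^^ n) x) = (f ^^ n) (h x)" for n
    by (induction n) (simp_all add: conj kx)
  have "openin (subtopology circle M) (h ` U)"
    using homeomorphic_imp_open_map[OF h] U by (auto simp: open_map_def)
  then obtain V where V: "open V" "h ` U = V \<inter> M"
    using MS by (auto simp: circle_def openin_subtopology openin_open subtopology_subtopology inf_absorb2)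
  have "h x \<in> M" "V \<inter> M \<noteq> {}"
    using himg x V(2) U(2) by auto
  from circle_return_times_contain_rotation_interval
    [OF f(2) denjoy_rotation_number_irrational[OF f] M this(1) V(1) this(2)]
  obtain a b where ab: "a < b"
    "\<And>(n::nat) (m::int). a < real n * \<theta> + m \<Longrightarrow> real n * \<theta> + m < b \<Longrightarrow> (f ^^ n) (h x) \<in> V"
    by metis
  show thesis
  proof (rule that[OF ab(1)])
    fix n and m :: int
    assume "a < real n * \<theta> + m" "real n * \<theta> + m < b"
    then have "h ((k ^^ n) x) \<in> V" by (simp add: hkx ab(2))
    moreover have "h ((k ^^ n) x) \<in> M" using himg kx by blast
    ultimately have "h ((k ^^ n) x) \<in> h ` U" using V by blast
    then show "(k ^^ n) x \<in> U"
      using homeomorphic_imp_injective_map[OF h] UX kx by (auto simp: inj_on_def)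
  qed
qed

section \<open>Products\<close>

lemma homeomorphic_map_product:
  assumes "\<And>i. i \<in> I \<Longrightarrow> homeomorphic_map (X i) (Y i) (k i)"
  shows "homeomorphic_map (product_topology X I) (product_topology Y I) (\<lambda>x. \<lambda>i\<in>I. k i (x i))"
proof -
  have "\<exists>l. homeomorphic_maps (X i) (Y i) (k i) l" if "i \<in> I" for i
    using assms[OF that] by (simp add: homeomorphic_map_maps)
  then obtain l where l: "\<And>i. i \<in> I \<Longrightarrow> homeomorphic_maps (X i) (Y i) (k i) (l i)"
    by metis
  have cont: "continuous_map (product_topology X I) (product_topology Y I) (\<lambda>x. \<lambda>i\<in>I. g i (x i))"
    if "\<And>i. i \<in> I \<Longrightarrow> continuous_map (X i) (Y i) (g i)"
    for g and X :: "'a \<Rightarrow> 'x topology" and Y :: "'a \<Rightarrow> 'y topology"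
    unfolding continuous_map_componentwise
  proof (intro conjI ballI)
    fix i assume "i \<in> I"
    have "continuous_map (product_topology X I) (Y i) (g i \<circ> (\<lambda>x. x i))"
      using continuous_map_product_projection[OF \<open>i \<in> I\<close>] that[OF \<open>i \<in> I\<close>]
      by (rule continuous_map_compose)
    then show "continuous_map (product_topology X I) (Y i) (\<lambda>x. (\<lambda>i\<in>I. g i (x i)) i)"
      using \<open>i \<in> I\<close> by (simp add: o_def)
  qed auto
  have "homeomorphic_maps (product_topology X I) (product_topology Y I)
      (\<lambda>x. \<lambda>i\<in>I. k i (x i)) (\<lambda>y. \<lambda>i\<in>I. l i (y i))"
    unfolding homeomorphic_maps_def
    using l by (intro conjI cont)
      (auto simp: homeomorphic_maps_def PiE_iff extensional_def fun_eq_iff)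
  then show ?thesis
    unfolding homeomorphic_map_maps by blast
qed

lemma funpow_product_map:
  fixes k :: "'i \<Rightarrow> 'a \<Rightarrow> 'a"
  assumes "i \<in> I"
  shows "((\<lambda>x. \<lambda>i\<in>I. k i (x i)) ^^ n) x i = (k i ^^ n) (x i)"
  using assms by (induction n) auto

text \<open>
  Iterates of the product map act coordinatewise, so one common return time of the finitely many
  constrained coordinates brings the orbit into the box.\<close>

theorem proposition5p12:
  fixes I :: "'i set" and \<theta> :: "'i \<Rightarrow> real"
    and X :: "'i \<Rightarrow> 'a topology" and k :: "'i \<Rightarrow> 'a \<Rightarrow> 'a"
  assumes "\<And>i. i \<in> I \<Longrightarrow> restricted_denjoy_homeo (X i) (k i) (\<theta> i)"
    and "rat_independent_family (insert None (Some ` I)) (case_option 1 \<theta>)"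
  shows "minimal_homeo (product_topology X I) (\<lambda>x. \<lambda>i\<in>I. k i (x i))"
proof -
  let ?P = "product_topology X I" and ?k = "\<lambda>x. \<lambda>i\<in>I. k i (x i)"
  have "homeomorphic_map ?P ?P ?k"
    using assms(1) by (intro homeomorphic_map_product) (simp add: restricted_denjoy_homeo_def)
  moreover have "topspace ?P \<subseteq> T" if T: "closed_invariant ?P ?k T" and "T \<noteq> {}" for T
  proof
    fix y assume y: "y \<in> topspace ?P"
    show "y \<in> T"
    proof (rule ccontr)
      assume "y \<notin> T"
      have cl: "closedin ?P T" and inv: "?k ` T = T"
        using T by (auto simp: closed_invariant_def)
      obtain x where x: "x \<in> T" using \<open>T \<noteq> {}\<close> by blast
      have TP: "T \<subseteq> topspace ?P" using cl closedin_subset by blast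
      have "openin ?P (topspace ?P - T)" using cl by blast
      from product_topology_open_contains_basis[OF this, of y] y \<open>y \<notin> T\<close>
      obtain B where B: "y \<in> (\<Pi>\<^sub>E i\<in>I. B i)" "\<And>i. openin (X i) (B i)"
        "finite {i. B i \<noteq> topspace (X i)}" "(\<Pi>\<^sub>E i\<in>I. B i) \<subseteq> topspace ?P - T"
        by (metis Diff_iff)
      define J where "J = {i\<in>I. B i \<noteq> topspace (X i)}"
      have J: "finite J" "J \<subseteq> I"
        using B(3) by (auto simp: J_def)
      have "\<exists>a b. a < b \<and> (\<forall>(n::nat) (m::int). a < real n * \<theta> i + m \<longrightarrow> real n * \<theta> i + m < b
          \<longrightarrow> (k i ^^ n) (x i) \<in> B i)" if "i \<in> J" for i
      proof -
        have "i \<in> I" "x i \<in> topspace (X i)" "B i \<noteq> {}"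
          using that J x TP B(1) by (auto simp: PiE_iff)
        from restricted_denjoy_return_times[OF assms(1)[OF this(1)] this(2) B(2) this(3)]
        show ?thesis by metis
      qed
      then obtain a b where ab: "\<And>i. i \<in> J \<Longrightarrow> a i < b i"
        "\<And>i (n::nat) (m::int). i \<in> J \<Longrightarrow> a i < real n * \<theta> i + m \<Longrightarrow> real n * \<theta> i + m < b i
          \<Longrightarrow> (k i ^^ n) (x i) \<in> B i"
        by metis
      \<comment> \<open>One tolerance for all coordinates; the entry \<open>1\<close> covers the case of empty \<open>J\<close>.\<close>
      define \<epsilon> where "\<epsilon> = Min (insert 1 ((\<lambda>i. (b i - a i) / 2) ` J))"
      have "\<epsilon> > 0"
        using J(1) ab(1) by (auto simp: \<epsilon>_def)
      have \<epsilon>: "\<epsilon> \<le> (b i - a i) / 2" if "i \<in> J" for i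
        unfolding \<epsilon>_def by (rule Min_le) (use J(1) that in auto)
      obtain n m where nm: "\<And>i. i \<in> J \<Longrightarrow> \<bar>real n * \<theta> i + of_int (m i) - (a i + b i) / 2\<bar> < \<epsilon>"
        using kronecker_natural_multiplier[OF J \<open>\<epsilon> > 0\<close> assms(2), of "\<lambda>i. (a i + b i) / 2"] by blast
      have inB: "(k i ^^ n) (x i) \<in> B i" if "i \<in> J" for i
        using nm[OF that] \<epsilon>[OF that] by (intro ab(2)[OF that, of n "m i"]) (auto simp: abs_less_iff field_simps)
      have inT: "(?k ^^ n) x \<in> T"
        by (rule funpow_in_invariant[OF inv x])
      then have ext: "(?k ^^ n) x \<in> topspace ?P" using TP by blast
      have "(?k ^^ n) x i \<in> B i" if "i \<in> I" for i
      proof (cases "i \<in> J")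
        case True
        then show ?thesis using inB that by (simp add: funpow_product_map)
      next
        case False
        then show ?thesis using ext that by (auto simp: J_def PiE_iff)
      qed
      then have "(?k ^^ n) x \<in> (\<Pi>\<^sub>E i\<in>I. B i)"
        using ext by (auto simp: PiE_iff)
      with B(4) inT show False by blast
    qed
  qed
  ultimately show ?thesis
    using closedin_subset[of ?P] by (fastforce simp: minimal_homeo_def closed_invariant_def)
qed

end
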